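(* Let $n$ be a positive integer. Inside the $n\times n$ table, for all integers $1\leq s,t\leq n$, $$\mathcal{C}^1(s,t)=\sum_{i=0}^{\lfloor\frac{s-t}{2}\rfloor}\frac{t}{t+i}\binom{s-1}{s-t-2i}\binom{t+2i-1}{i}.$$
   Context: The $n\times n$ table has $n$ rows and $n$ columns; the $(x,y)$-cell is the cell in column $x$ and row $y$, $1\leq x,y\leq n$. A lattice path inside the table is a sequence of cells of the table in which consecutive cells differ by an allowed step. $\mathcal{C}^1(s,t)$ is the number of lattice paths inside the table from the $(1,1)$-cell to the $(s,t)$-cell with steps in $\{(1,1),(1,0),(1,-1)\}$. A sum whose upper limit is less than its lower limit is $0$. *)

theory Defs
  imports Complex_Main "HOL-Library.Product_Plus"
begin

text \<open>Cells are pairs (column, row); steps are differences of cells.\<close>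

definition table :: "nat \<Rightarrow> (int \<times> int) set" where
  "table n = {1..int n} \<times> {1..int n}"

definition lattice_paths ::
    "nat \<Rightarrow> (int \<times> int) set \<Rightarrow> int \<times> int \<Rightarrow> int \<times> int \<Rightarrow> (int \<times> int) list set" where
  "lattice_paths n S a b =
     {p. p \<noteq> [] \<and> hd p = a \<and> last p = b \<and> set p \<subseteq> table n \<and>
         successively (\<lambda>u v. v - u \<in> S) p}"

text \<open>Every step in the step set below increases the column by one, so the set of paths
  counted here is finite and the cardinality is the true number of paths.\<close>

definition C1 :: "nat \<Rightarrow> nat \<Rightarrow> nat \<Rightarrow> nat" where
  "C1 n s t = card (lattice_paths n {(1, 1), (1, 0), (1, -1)} (1, 1) (int s, int t))"

end

theory Submission
  imports Defs
begin

text \<open>A path to column \<open>s\<close> never climbs above row \<open>s\<close>, so the upper border of the table is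
  irrelevant and the paths are Motzkin prefixes. Choosing which \<open>N\<close> of the \<open>s - 1\<close> steps
  are not horizontal leaves a Dyck prefix of length \<open>N\<close>, counted by the ballot numbers.\<close>

section \<open>Ballot numbers: Dyck prefixes from height 1\<close>

fun ballot :: "nat \<Rightarrow> nat \<Rightarrow> nat" where
  "ballot N 0 = 0"
| "ballot 0 (Suc k) = (if k = 0 then 1 else 0)"
| "ballot (Suc N) (Suc k) = ballot N k + ballot N (Suc (Suc k))"

text \<open>Starting at height 1, \<open>N\<close> unit steps of which \<open>i\<close> go down end
  at height \<open>t\<close> exactly when \<open>t + 2 * i = Suc N\<close>. If no \<open>i\<close>
  fits, \<open>t\<close> has the wrong parity or is too high.\<close>

lemma ballot_eq_0:
  assumes "\<And>i. t + 2 * i \<noteq> Suc N"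
  shows "ballot N t = 0"
  using assms
proof (induction N t rule: ballot.induct)
  case (2 k)
  from "2.prems"[of 0] show ?case by simp
next
  case (3 N k)
  have "k + 2 * i \<noteq> Suc N" and "Suc (Suc k) + 2 * i \<noteq> Suc N" for i
    using "3.prems"[of i] "3.prems"[of "Suc i"] by auto
  with "3.IH" show ?case by simp
qed simp

text \<open>At \<open>t = 0\<close> the right-hand side vanishes by the symmetry of the binomial
  coefficients, which is the reflection principle.\<close>

lemma ballot_eq_binomial_diff:
  assumes "t + 2 * i = Suc N"
  shows "int (ballot N t) = int (N choose i) - (if i = 0 then 0 else int (N choose (i - 1)))"
  using assms
proof (induction N t arbitrary: i rule: ballot.induct)
  case (1 N)
  then obtain j where i: "i = Suc j" by (cases i) auto
  have "N choose i = N choose (N - i)"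
    using 1 i by (intro binomial_symmetric) auto
  moreover have "N - i = j" using 1 i by simp
  ultimately show ?case using i by simp
next
  case (2 k)
  then show ?case by auto
next
  case (3 N k)
  have left: "int (ballot N k) = int (N choose i) - (if i = 0 then 0 else int (N choose (i - 1)))"
    using 3 by simp
  show ?case
  proof (cases i)
    \<comment> \<open>Without down steps, height \<open>Suc (Suc k)\<close> is out of reach after
      \<open>N\<close> steps.\<close>
    case 0
    then have "ballot N (Suc (Suc k)) = 0"
      using "3.prems" by (intro ballot_eq_0) simp
    with left 0 show ?thesis by simp
  next
    \<comment> \<open>A last step from \<open>Suc (Suc k)\<close> goes down, so \<open>j\<close>
      down steps precede it; Pascal's rule then combines the two predecessors.\<close>
    case (Suc j)
    have "int (ballot N (Suc (Suc k))) =
        int (N choose j) - (if j = 0 then 0 else int (N choose (j - 1)))"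
      using "3.prems" Suc by (intro "3.IH") simp
    with left Suc show ?thesis by (cases j) simp_all
  qed
qed

text \<open>After multiplication by \<open>t + i\<close>, absorption turns the subtracted binomial
  into \<open>i * (N choose i)\<close>, which leaves the factor \<open>t\<close>.\<close>

lemma ballot_closed_form:
  assumes "1 \<le> t"
  shows "real (ballot (t + 2 * i - 1) t) =
    real t / real (t + i) * real ((t + 2 * i - 1) choose i)"
proof -
  define N where "N = t + 2 * i - 1"
  have N: "t + 2 * i = Suc N" using assms by (simp add: N_def)
  have diff: "real (ballot N t) =
      real (N choose i) - (if i = 0 then 0 else real (N choose (i - 1)))"
    using arg_cong[OF ballot_eq_binomial_diff[OF N], of real_of_int] by (simp split: if_splits)
  have "real (t + i) * real (ballot N t) = real t * real (N choose i)"
  proof (cases i)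
    case 0
    with diff show ?thesis by simp
  next
    case (Suc j)
    have "N - j = t + i" using N Suc by simp
    \<comment> \<open>Both sides equal \<open>N * ((N - 1) choose j)\<close>.\<close>
    then have "Suc j * (N choose Suc j) = (t + i) * (N choose j)"
      using binomial_absorb_comp[of N j] binomial_absorption[of j N] by simp
    then have "real i * real (N choose i) = real (t + i) * real (N choose j)"
      using Suc by (metis of_nat_mult)
    moreover have "real (t + i) * real (ballot N t) =
        real (t + i) * real (N choose i) - real (t + i) * real (N choose j)"
      by (simp add: diff Suc right_diff_distrib)
    ultimately show ?thesis by (simp only: of_nat_add distrib_right)
  qed
  then show ?thesis
    using assms unfolding N_def[symmetric] by (simp add: field_simps)
qed

section \<open>Motzkin prefixes and their recursion\<close>

definition motzkin_prefixes :: "nat \<Rightarrow> nat \<Rightarrow> nat" where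
  "motzkin_prefixes m t = (\<Sum>N\<le>m. (m choose N) * ballot N t)"

lemma motzkin_prefixes_0_right [simp]: "motzkin_prefixes m 0 = 0"
  by (simp add: motzkin_prefixes_def)

text \<open>From height 1, \<open>m\<close> steps climb to at most \<open>Suc m\<close>. This makes
  the formula vanish just above the table.\<close>

lemma motzkin_prefixes_eq_0:
  assumes "Suc m < t"
  shows "motzkin_prefixes m t = 0"
  unfolding motzkin_prefixes_def using assms by (intro sum.neutral) (auto intro!: ballot_eq_0)

text \<open>Pascal's rule on the positions of the non-horizontal steps separates a horizontal last
  step from a non-horizontal one; the latter splits further by the recursion of
  \<open>ballot\<close>.\<close>

lemma motzkin_prefixes_Suc:
  "motzkin_prefixes (Suc m) (Suc k) =
    motzkin_prefixes m k + motzkin_prefixes m (Suc k) + motzkin_prefixes m (Suc (Suc k))"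
proof -
  have "motzkin_prefixes (Suc m) (Suc k) =
      ballot 0 (Suc k) + (\<Sum>N\<le>m. (Suc m choose Suc N) * ballot (Suc N) (Suc k))"
    unfolding motzkin_prefixes_def by (subst sum.atMost_Suc_shift) simp
  also have "\<dots> = (\<Sum>N\<le>m. (m choose N) * ballot (Suc N) (Suc k)) +
      (ballot 0 (Suc k) + (\<Sum>N\<le>m. (m choose Suc N) * ballot (Suc N) (Suc k)))"
    by (simp only: binomial_Suc_Suc distrib_right sum.distrib add_ac)
  \<comment> \<open>The summand \<open>N = 0\<close> rejoins the sum; the extra one at
    \<open>N = Suc m\<close> is zero.\<close>
  also have "ballot 0 (Suc k) + (\<Sum>N\<le>m. (m choose Suc N) * ballot (Suc N) (Suc k)) =
      (\<Sum>N\<le>Suc m. (m choose N) * ballot N (Suc k))"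
    by (subst sum.atMost_Suc_shift) simp
  also have "\<dots> = motzkin_prefixes m (Suc k)"
    by (simp add: motzkin_prefixes_def)
  finally show ?thesis
    by (simp add: motzkin_prefixes_def distrib_left sum.distrib)
qed

section \<open>Decomposing lattice paths by their last step\<close>

text \<open>Borders become zero counts, so the recursion needs no case distinction on the previous
  cell.\<close>

lemma lattice_paths_outside:
  assumes "b \<notin> table n"
  shows "lattice_paths n S a b = {}"
  using assms last_in_set unfolding lattice_paths_def by blast

lemma lattice_paths_last_step:
  assumes "b \<in> table n"
  shows "lattice_paths n S a b =
    (if a = b then {[a]} else {}) \<union> (\<Union>d\<in>S. (\<lambda>q. q @ [b]) ` lattice_paths n S a (b - d))"
    (is "?L = ?R")
proof
  show "?L \<subseteq> ?R"
  proof
    fix p assume p: "p \<in> ?L"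
    define q where "q = butlast p"
    have q: "p = q @ [b]"
      using p append_butlast_last_id[of p] by (simp add: lattice_paths_def q_def)
    show "p \<in> ?R"
    proof (cases "q = []")
      case True
      with p q show ?thesis by (auto simp: lattice_paths_def)
    next
      case False
      then have "b - last q \<in> S" and "q \<in> lattice_paths n S a (b - (b - last q))"
        using p q by (auto simp: lattice_paths_def successively_append_iff)
      with q show ?thesis by blast
    qed
  qed
  show "?R \<subseteq> ?L"
    using assms by (auto simp: lattice_paths_def successively_append_iff split: if_splits)
qed

text \<open>The union is disjoint because the cell before \<open>b\<close> determines
  \<open>d\<close>; \<open>a \<noteq> b\<close> excludes the one-cell path.\<close>

lemma card_lattice_paths_last_step:
  assumes "b \<in> table n" and "a \<noteq> b" and "finite S"
    and "\<And>d. d \<in> S \<Longrightarrow> finite (lattice_paths n S a (b - d))"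
  shows "card (lattice_paths n S a b) = (\<Sum>d\<in>S. card (lattice_paths n S a (b - d)))"
proof -
  have "card (lattice_paths n S a b) =
      (\<Sum>d\<in>S. card ((\<lambda>q. q @ [b]) ` lattice_paths n S a (b - d)))"
    unfolding lattice_paths_last_step[OF assms(1)] using assms(2-)
    by (simp, intro card_UN_disjoint) (auto simp: lattice_paths_def)
  also have "\<dots> = (\<Sum>d\<in>S. card (lattice_paths n S a (b - d)))"
    by (intro sum.cong refl card_image) (auto simp: inj_on_def)
  finally show ?thesis .
qed

abbreviation motzkin_steps :: "(int \<times> int) set" where
  "motzkin_steps \<equiv> {(1, 1), (1, 0), (1, -1)}"

text \<open>Any step into column 1 would come from column 0, outside the table.\<close>

lemma lattice_paths_first_column:
  "lattice_paths n motzkin_steps (1, 1) (1, y) = (if y = 1 \<and> 1 \<le> n then {[(1, 1)]} else {})"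
proof (cases "(1, y) \<in> table n")
  case True
  have "lattice_paths n motzkin_steps (1, 1) ((1, y) - d) = {}" if "d \<in> motzkin_steps" for d
    using that by (intro lattice_paths_outside) (auto simp: table_def)
  then have "(\<Union>d\<in>motzkin_steps.
      (\<lambda>q. q @ [(1, y)]) ` lattice_paths n motzkin_steps (1, 1) ((1, y) - d)) = {}"
    by blast
  with lattice_paths_last_step[OF True, of motzkin_steps "(1, 1)"] True show ?thesis
    by (auto simp: table_def)
next
  case False
  then show ?thesis by (auto simp: lattice_paths_outside table_def)
qed

text \<open>Row \<open>n + 1\<close> is included because the recursion at row \<open>n\<close> refers to it.\<close>

lemma C1_eq_motzkin_prefixes:
  assumes "Suc m \<le> n" and "t \<le> Suc n"
  shows "finite (lattice_paths n motzkin_steps (1, 1) (int (Suc m), int t)) \<and>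
    C1 n (Suc m) t = motzkin_prefixes m t"
  using assms
proof (induction m arbitrary: t)
  case 0
  have "motzkin_prefixes 0 t = (if t = 1 then 1 else 0)"
    by (cases t) (auto simp: motzkin_prefixes_def)
  with 0 show ?case by (simp add: C1_def lattice_paths_first_column)
next
  case (Suc m)
  let ?P = "lattice_paths n motzkin_steps (1, 1)"
  show ?case
  proof (cases "1 \<le> t \<and> t \<le> n")
    \<comment> \<open>The row is 0 or \<open>Suc n\<close>. In the latter case
      \<open>Suc (Suc m) \<le> n < t\<close>, so \<open>t\<close> is too high to reach.\<close>
    case False
    then have "(int (Suc (Suc m)), int t) \<notin> table n" by (auto simp: table_def)
    then have "?P (int (Suc (Suc m)), int t) = {}" by (rule lattice_paths_outside)
    moreover have "motzkin_prefixes (Suc m) t = 0"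
      using False Suc.prems by (cases t) (auto intro: motzkin_prefixes_eq_0)
    ultimately show ?thesis by (simp add: C1_def)
  next
    case True
    then obtain k where k: "t = Suc k" by (cases t) auto
    define b where "b = (int (Suc (Suc m)), int t)"
    have b: "b \<in> table n" using True Suc.prems by (auto simp: table_def b_def)
    have prev: "b - (1, 1) = (int (Suc m), int k)" "b - (1, 0) = (int (Suc m), int (Suc k))"
      "b - (1, -1) = (int (Suc m), int (Suc (Suc k)))"
      by (simp_all add: b_def k)
    \<comment> \<open>The induction carries finiteness along because the cardinality of the union
      relies on it.\<close>
    have fin: "finite (?P (b - d))" if "d \<in> motzkin_steps" for d
      using that Suc.IH[of k] Suc.IH[of "Suc k"] Suc.IH[of "Suc (Suc k)"] Suc.prems(1) True k
      by (auto simp only: insert_iff empty_iff prev)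
    have "finite (?P b)"
      unfolding lattice_paths_last_step[OF b] using fin by simp
    moreover have "card (?P b) = (\<Sum>d\<in>motzkin_steps. card (?P (b - d)))"
      using b fin by (intro card_lattice_paths_last_step) (auto simp: b_def)
    then have "C1 n (Suc (Suc m)) t =
        C1 n (Suc m) k + C1 n (Suc m) (Suc k) + C1 n (Suc m) (Suc (Suc k))"
      using prev by (simp add: C1_def b_def k)
    moreover have "\<dots> = motzkin_prefixes (Suc m) t"
      using Suc.IH[of k] Suc.IH[of "Suc k"] Suc.IH[of "Suc (Suc k)"] Suc.prems True k
      by (simp add: motzkin_prefixes_Suc)
    ultimately show ?thesis by (simp add: b_def)
  qed
qed

section \<open>Summation over the number of down steps\<close>

text \<open>By \<open>ballot_eq_0\<close> only lengths with \<open>Suc N = t + 2 * i\<close>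
  contribute, and \<open>i\<close> becomes the new index.\<close>

lemma motzkin_prefixes_sum:
  assumes "1 \<le> t"
  shows "motzkin_prefixes m t =
    (\<Sum>i | t + 2 * i \<le> Suc m. (m choose (t + 2 * i - 1)) * ballot (t + 2 * i - 1) t)"
proof -
  let ?I = "{i. t + 2 * i \<le> Suc m}" and ?f = "\<lambda>i. t + 2 * i - 1"
  have "motzkin_prefixes m t = (\<Sum>N\<in>?f ` ?I. (m choose N) * ballot N t)"
    unfolding motzkin_prefixes_def
  proof (rule sum.mono_neutral_right)
    have "ballot N t = 0" if N: "N \<in> {..m} - ?f ` ?I" for N
    proof (rule ballot_eq_0)
      fix i
      show "t + 2 * i \<noteq> Suc N"
      proof
        assume eq: "t + 2 * i = Suc N"
        then have "N = ?f i" by simp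
        moreover have "i \<in> ?I" using N eq by simp
        ultimately show False using N by blast
      qed
    qed
    then show "\<forall>N\<in>{..m} - ?f ` ?I. (m choose N) * ballot N t = 0" by simp
  qed auto
  also have "\<dots> = (\<Sum>i\<in>?I. (m choose ?f i) * ballot (?f i) t)"
    by (subst sum.reindex) (use assms in \<open>auto simp: inj_on_def\<close>)
  finally show ?thesis .
qed

theorem corollary2p4:
  fixes n s t :: nat
  assumes "n \<ge> 1" and "1 \<le> s" and "s \<le> n" and "1 \<le> t" and "t \<le> n"
  shows "real (C1 n s t) =
    (\<Sum>i\<in>{i::nat. int i \<le> \<lfloor>(real s - real t) / 2\<rfloor>}.
       real t / real (t + i) * real ((s - 1) choose (s - t - 2 * i))
         * real ((t + 2 * i - 1) choose i))"
proof -
  define m where "m = s - 1"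
  have s: "s = Suc m" using assms by (simp add: m_def)
  \<comment> \<open>For \<open>s < t\<close> the floor is negative and both sets are empty.\<close>
  have index: "{i::nat. int i \<le> \<lfloor>(real s - real t) / 2\<rfloor>} = {i. t + 2 * i \<le> Suc m}"
    by (auto simp: le_floor_iff s)
  have "real (C1 n s t) = real (motzkin_prefixes m t)"
    using C1_eq_motzkin_prefixes[of m n t] assms s by simp
  also have "\<dots> = (\<Sum>i | t + 2 * i \<le> Suc m.
      real (m choose (t + 2 * i - 1)) * real (ballot (t + 2 * i - 1) t))"
    using assms by (simp add: motzkin_prefixes_sum)
  also have "\<dots> = (\<Sum>i | t + 2 * i \<le> Suc m.
      real t / real (t + i) * real ((s - 1) choose (s - t - 2 * i))
        * real ((t + 2 * i - 1) choose i))"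
  proof (rule sum.cong[OF refl])
    fix i assume i: "i \<in> {i. t + 2 * i \<le> Suc m}"
    \<comment> \<open>Choose the positions of the \<open>s - t - 2 * i\<close> horizontal steps
      instead.\<close>
    have "m choose (t + 2 * i - 1) = m choose (m - (t + 2 * i - 1))"
      using i by (intro binomial_symmetric) auto
    moreover have "m - (t + 2 * i - 1) = s - t - 2 * i"
      using assms s by simp
    ultimately have "m choose (t + 2 * i - 1) = (s - 1) choose (s - t - 2 * i)"
      by (simp add: m_def)
    then show "real (m choose (t + 2 * i - 1)) * real (ballot (t + 2 * i - 1) t) =
        real t / real (t + i) * real ((s - 1) choose (s - t - 2 * i))
          * real ((t + 2 * i - 1) choose i)"
      using ballot_closed_form[OF assms(4), of i] by (simp only: mult_ac)
  qed
  finally show ?thesis unfolding index .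
qed

end
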